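(* Let $r_p,h_p,a_{lo},a_{max},v_{max}$ be real parameters and $r,h,v,w,v_{lo},r_v$ real state variables. The following differential game logic formula is valid: $$\Big(r_p\ge0\wedge h_p>0\wedge r_v\ge0\wedge a_{lo}>0\wedge v_{max}>0\wedge(w=-1\vee w=1)\wedge a_{max}\ge a_{lo}\wedge L^{H-1}_{impl}(r,h,v,w,v_{lo})\Big)\to[\alpha_3^*]\big(|r|>r_p\vee|h|>h_p\big),$$ where $$\alpha_3\equiv\Big(?\mathit{true}\cup\big((w:=1\cup w:=-1);\ v_{lo}:=*;\ ?L^{H-1}_{impl}(r,h,v,w,v_{lo});\ \mathit{adv}:=(w,v_{lo})\big)\Big);\ \big(a_o:=*;\ ?(-a_{max}\le a_o\le a_{max})\big)^d;\ \Big(r_v:=*;\ ?(0\le r_v\le v_{max});\ \{r'=-r_v,\ h'=-v,\ v'=a_o\}\Big)^*.$$ That is, from every state satisfying the precondition the ownship has a winning strategy guaranteeing no near mid-air collision against every horizontally-maneuvering intruder choosing closure rates in $[0,v_{max}]$.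
   Context: Game semantics (differential game logic dGL). A hybrid game is played between the ownship (the player who must establish the postcondition) and the opponent. A formula $P\to[\alpha]Q$ is valid iff from every state satisfying $P$ the ownship has a strategy in $\alpha$ such that every play it allows ends (whenever it ends) in a state satisfying $Q$. Constructs: $x:=e$ assigns; $x:=*$ the opponent picks an arbitrary real value; $?\phi$ test: if $\phi$ is false the opponent loses; $\alpha;\beta$ sequential; $\alpha\cup\beta$ opponent chooses; $\alpha^*$ opponent decides before each round whether to continue or stop ($Q$ must hold after every finite number of rounds, including zero); $\{x'=f(x)\}$ follows the ODE for a nonnegative duration chosen by the opponent; $\alpha^d$ swaps roles: inside, the ownship makes all choices and a failed test makes the ownship lose. $\mathit{adv}:=(w,v_{lo})$ is a bookkeeping assignment to a variable not occurring elsewhere. Interpretation: $r,h$ horizontal/vertical separation, $v$ relative vertical velocity, $r_v$ horizontal closure rate (controlled by the intruder), $a_o$ ownship vertical acceleration, $(w,v_{lo})$ advisory. Safe region: $T_{lo}(v,w,v_{lo})\equiv\frac{\max(0,w(v_{lo}-v))}{a_{lo}}$; $A_{lo}(v,w,v_{lo},h_n,t)\equiv\big(0\le t<T_{lo}(v,w,v_{lo})\wedge h_n=\frac{wa_{lo}}2t^2+vt\big)\vee\big(t\ge T_{lo}(v,w,v_{lo})\wedge h_n=v_{lo}t-\frac{w\max(0,w(v_{lo}-v))^2}{2a_{lo}}\big)$; $L^{H-1}_{impl}(r,h,v,w,v_{lo})\equiv\forall t\,\forall r_v\,\forall r_n\,\forall h_n\big(r_v\in[0,v_{max}]\wedge r_n=r_vt\wedge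 A_{lo}(v,w,v_{lo},h_n,t)\to(|r-r_n|>r_p\vee w(h_n-h)>h_p)\big)$. *)

theory Defs
  imports Complex_Main
begin

text \<open>
  Hybrid games of differential game logic over a type of variables \<open>'v\<close>.  Terms and formulas are
  embedded shallowly, as functions on states.  The constructors carry no player: whoever is in
  charge of a game resolves its choices and has to pass its tests.  In a box formula the opponent
  is in charge of the whole game, and \<open>Dual\<close> hands control over to the other player.
\<close>

type_synonym 'v state = "'v \<Rightarrow> real"

datatype 'v game =
    Assign 'v "'v state \<Rightarrow> real"
  | AssignAny 'v
  | Test "'v state \<Rightarrow> bool"
  | Evolve "('v \<times> ('v state \<Rightarrow> real)) list"
  | Seq "'v game" "'v game"  (infixr ";;" 60)
  | Choice "'v game" "'v game"
  | Loop "'v game"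
  | Dual "'v game"

datatype player = Ownship | Opponent

fun other :: "player \<Rightarrow> player" where
  "other Ownship = Opponent"
| "other Opponent = Ownship"

text \<open>
  \<open>ode_reach ode s s'\<close>: some solution of the differential equations of some duration \<open>T \<ge> 0\<close> leads
  from \<open>s\<close> to \<open>s'\<close>; variables without an equation keep their value.  For \<open>T = 0\<close> the derivative
  condition is void, as it should be.
\<close>

definition ode_reach :: "('v \<times> ('v state \<Rightarrow> real)) list \<Rightarrow> 'v state \<Rightarrow> 'v state \<Rightarrow> bool" where
  "ode_reach ode s s' \<longleftrightarrow>
     (\<exists>T::real. \<exists>\<phi>::real \<Rightarrow> 'v state. T \<ge> 0 \<and> \<phi> 0 = s \<and> \<phi> T = s' \<and>
        (\<forall>t\<in>{0..T}.
           (\<forall>(x, f)\<in>set ode. ((\<lambda>u. \<phi> u x) has_real_derivative f (\<phi> t)) (at t within {0..T})) \<and>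
           (\<forall>x. x \<notin> fst ` set ode \<longrightarrow> \<phi> t x = s x)))"

text \<open>
  A position is the stack of games still to be played, each with the player in charge of it,
  together with the current state.  With an empty stack the play has ended.  The player in charge
  of the topmost game is to move; having no move (which happens only at a failed test) means losing.
\<close>

type_synonym 'v position = "(player \<times> 'v game) list \<times> 'v state"

fun to_move :: "'v position \<Rightarrow> player option" where
  "to_move ([], s) = None"
| "to_move ((p, a) # K, s) = Some p"

fun moves :: "'v position \<Rightarrow> 'v position set" where
  "moves ([], s) = {}"
| "moves ((p, Assign x e) # K, s) = {(K, s(x := e s))}"
| "moves ((p, AssignAny x) # K, s) = {(K, s(x := c)) | c. True}"
| "moves ((p, Test P) # K, s) = (if P s then {(K, s)} else {})"
| "moves ((p, Evolve ode) # K, s) = {(K, s') | s'. ode_reach ode s s'}"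
| "moves ((p, a ;; b) # K, s) = {((p, a) # (p, b) # K, s)}"
| "moves ((p, Choice a b) # K, s) = {((p, a) # K, s), ((p, b) # K, s)}"
| "moves ((p, Loop a) # K, s) = {(K, s), ((p, a) # (p, Loop a) # K, s)}"
| "moves ((p, Dual a) # K, s) = {((other p, a) # K, s)}"

text \<open>
  An ownship strategy maps histories (latest position first) to the next position.
  \<open>play \<sigma> c \<pi>\<close>: the history \<open>\<pi>\<close> is a finite, possibly unfinished play from \<open>c\<close> allowed by \<open>\<sigma>\<close>.
\<close>

type_synonym 'v strategy = "'v position list \<Rightarrow> 'v position"

inductive play :: "'v strategy \<Rightarrow> 'v position \<Rightarrow> 'v position list \<Rightarrow> bool" for \<sigma> c where
  start: "play \<sigma> c [c]"
| step: "play \<sigma> c (d # \<pi>) \<Longrightarrow> e \<in> moves d \<Longrightarrow> (to_move d = Some Ownship \<longrightarrow> e = \<sigma> (d # \<pi>)) \<Longrightarrow>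
    play \<sigma> c (e # d # \<pi>)"

text \<open>
  A winning strategy always makes a legal move when the ownship is to move (so the ownship never
  fails a test), and every play that ends does so in \<open>Q\<close>.  Plays that never end, and plays in which
  the opponent fails a test, put no requirement on \<open>Q\<close>.
  (For a \<open>Loop\<close> controlled by the ownship, differential game logic would in addition have the
  ownship lose if it never stops; such loops are not used below.)
\<close>

definition winning :: "'v strategy \<Rightarrow> 'v position \<Rightarrow> ('v state \<Rightarrow> bool) \<Rightarrow> bool" where
  "winning \<sigma> c Q \<longleftrightarrow>
     (\<forall>d \<pi>. play \<sigma> c (d # \<pi>) \<longrightarrow>
        (case to_move d of
           None \<Rightarrow> Q (snd d)
         | Some Ownship \<Rightarrow> \<sigma> (d # \<pi>) \<in> moves d
         | Some Opponent \<Rightarrow> True))"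

definition box :: "'v game \<Rightarrow> ('v state \<Rightarrow> bool) \<Rightarrow> 'v state \<Rightarrow> bool" where
  "box a Q s \<longleftrightarrow> (\<exists>\<sigma>. winning \<sigma> ([(Opponent, a)], s) Q)"

definition valid :: "('v state \<Rightarrow> bool) \<Rightarrow> bool" where
  "valid P \<longleftrightarrow> (\<forall>s. P s)"

definition T_lo :: "real \<Rightarrow> real \<Rightarrow> real \<Rightarrow> real \<Rightarrow> real" where
  "T_lo a_lo v w v_lo = max 0 (w * (v_lo - v)) / a_lo"

definition A_lo :: "real \<Rightarrow> real \<Rightarrow> real \<Rightarrow> real \<Rightarrow> real \<Rightarrow> real \<Rightarrow> bool" where
  "A_lo a_lo v w v_lo h_n t \<longleftrightarrow>
     (0 \<le> t \<and> t < T_lo a_lo v w v_lo \<and> h_n = w * a_lo / 2 * t\<^sup>2 + v * t) \<or>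
     (t \<ge> T_lo a_lo v w v_lo \<and> h_n = v_lo * t - w * (max 0 (w * (v_lo - v)))\<^sup>2 / (2 * a_lo))"

definition L_impl ::
    "real \<Rightarrow> real \<Rightarrow> real \<Rightarrow> real \<Rightarrow> real \<Rightarrow> real \<Rightarrow> real \<Rightarrow> real \<Rightarrow> real \<Rightarrow> bool" where
  "L_impl r_p h_p a_lo v_max r h v w v_lo \<longleftrightarrow>
     (\<forall>t r_v r_n h_n.
        r_v \<in> {0..v_max} \<and> r_n = r_v * t \<and> A_lo a_lo v w v_lo h_n t \<longrightarrow>
        \<bar>r - r_n\<bar> > r_p \<or> w * (h_n - h) > h_p)"

text \<open>
  The pair-valued variable \<open>adv\<close> is split into its two components.  The parameters
  \<open>r_p, h_p, a_lo, a_max, v_max\<close> are never modified by the game and therefore are not part of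
  the state.
\<close>

datatype var = X_r | X_h | X_v | X_w | X_vlo | X_rv | X_ao | X_adv_w | X_adv_vlo

definition L_state :: "real \<Rightarrow> real \<Rightarrow> real \<Rightarrow> real \<Rightarrow> var state \<Rightarrow> bool" where
  "L_state r_p h_p a_lo v_max s \<longleftrightarrow>
     L_impl r_p h_p a_lo v_max (s X_r) (s X_h) (s X_v) (s X_w) (s X_vlo)"

definition alpha3 :: "real \<Rightarrow> real \<Rightarrow> real \<Rightarrow> real \<Rightarrow> real \<Rightarrow> var game" where
  "alpha3 r_p h_p a_lo a_max v_max =
     Choice
       (Test (\<lambda>s. True))
       (Choice (Assign X_w (\<lambda>s. 1)) (Assign X_w (\<lambda>s. - 1)) ;;
        AssignAny X_vlo ;;
        Test (L_state r_p h_p a_lo v_max) ;;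
        (Assign X_adv_w (\<lambda>s. s X_w) ;; Assign X_adv_vlo (\<lambda>s. s X_vlo))) ;;
     Dual (AssignAny X_ao ;; Test (\<lambda>s. - a_max \<le> s X_ao \<and> s X_ao \<le> a_max)) ;;
     Loop
       (AssignAny X_rv ;;
        Test (\<lambda>s. 0 \<le> s X_rv \<and> s X_rv \<le> v_max) ;;
        Evolve [(X_r, \<lambda>s. - s X_rv), (X_h, \<lambda>s. - s X_v), (X_v, \<lambda>s. s X_ao)])"

end

theory Submission
  imports Defs
begin

text \<open>
  The ownship always accelerates at \<open>w * a_lo\<close>.  Measured in the direction \<open>w\<close>, it then climbs at
  least as far as the nominal trajectory behind \<open>L_impl\<close>, even after overshooting the target
  velocity \<open>v_lo\<close>.  On the horizontal side, following a closure rate from the interval \<open>[0, v_max]\<close>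
  for some time and then another one covers a distance that a single rate from that interval covers
  in the total time.  Hence \<open>L_impl\<close> is an invariant of both loops, and at time \<open>0\<close> it yields the
  postcondition.
\<close>

section \<open>Weakest preconditions with either player in charge\<close>

text \<open>
  An ownship loop that never stops is not counted as lost here, in agreement with \<^const>\<open>winning\<close>.
\<close>

fun wp :: "player \<Rightarrow> 'v game \<Rightarrow> ('v state \<Rightarrow> bool) \<Rightarrow> 'v state \<Rightarrow> bool" where
  "wp p (Assign x e) X s \<longleftrightarrow> X (s(x := e s))"
| "wp Ownship (AssignAny x) X s \<longleftrightarrow> (\<exists>c. X (s(x := c)))"
| "wp Opponent (AssignAny x) X s \<longleftrightarrow> (\<forall>c. X (s(x := c)))"
| "wp Ownship (Test P) X s \<longleftrightarrow> P s \<and> X s"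
| "wp Opponent (Test P) X s \<longleftrightarrow> (P s \<longrightarrow> X s)"
| "wp Ownship (Evolve ode) X s \<longleftrightarrow> (\<exists>s'. ode_reach ode s s' \<and> X s')"
| "wp Opponent (Evolve ode) X s \<longleftrightarrow> (\<forall>s'. ode_reach ode s s' \<longrightarrow> X s')"
| "wp p (a ;; b) X s \<longleftrightarrow> wp p a (wp p b X) s"
| "wp Ownship (Choice a b) X s \<longleftrightarrow> wp Ownship a X s \<or> wp Ownship b X s"
| "wp Opponent (Choice a b) X s \<longleftrightarrow> wp Opponent a X s \<and> wp Opponent b X s"
| "wp Ownship (Loop a) X s \<longleftrightarrow> (\<exists>J. J s \<and> (\<forall>s. J s \<longrightarrow> X s \<or> wp Ownship a J s))"
| "wp Opponent (Loop a) X s \<longleftrightarrow> (\<exists>J. J s \<and> (\<forall>s. J s \<longrightarrow> X s \<and> wp Opponent a J s))"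
| "wp p (Dual a) X s \<longleftrightarrow> wp (other p) a X s"

lemma wp_mono:
  assumes "wp p a X s" and "\<And>s. X s \<Longrightarrow> Y s"
  shows "wp p a Y s"
  using assms
proof (induction a arbitrary: p X Y s)
  case (Seq a b)
  have "wp p a (wp p b Y) s"
    by (rule Seq.IH(1)[of p "wp p b X"]) (use Seq in auto)
  then show ?case by simp
next
  case (Choice a b)
  then show ?case by (cases p) (simp, blast)+
next
  case (Loop a)
  show ?case
  proof (cases p)
    case Ownship
    then show ?thesis
      using Loop.prems unfolding Ownship wp.simps by blast
  next
    case Opponent
    then show ?thesis
      using Loop.prems unfolding Opponent wp.simps by blast
  qed
next
  case (Dual a)
  show ?case
    using Dual.IH[of "other p" X s Y] Dual.prems by simp
next
  case (Assign x e)
  then show ?case by simp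
next
  case (AssignAny x)
  then show ?case by (cases p) (simp, blast)+
next
  case (Test P)
  then show ?case by (cases p) simp_all
next
  case (Evolve ode)
  then show ?case by (cases p) (simp_all, blast)
qed

lemma wp_Loop_invariant:
  assumes "J s" "\<And>s. J s \<Longrightarrow> X s" "\<And>s. J s \<Longrightarrow> wp Opponent a J s"
  shows "wp Opponent (Loop a) X s"
  unfolding wp.simps by (rule exI[of _ J]) (simp add: assms)

section \<open>From weakest preconditions to winning strategies\<close>

fun stack_wp :: "(player \<times> 'v game) list \<Rightarrow> ('v state \<Rightarrow> bool) \<Rightarrow> 'v state \<Rightarrow> bool" where
  "stack_wp [] X = X"
| "stack_wp ((p, a) # K) X = wp p a (stack_wp K X)"

text \<open>The loop clauses of \<open>wp\<close> encode a greatest fixpoint as the union of its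
  post-fixed points \<open>J\<close>. Each \<open>J\<close> lies inside this union, so monotonicity
  replaces \<open>J\<close> by the union after one round of the body.\<close>

lemma wp_Loop_unfold_Ownship:
  assumes "wp Ownship (Loop a) X s"
  shows "X s \<or> wp Ownship a (wp Ownship (Loop a) X) s"
proof -
  obtain J where J: "J s" "\<And>s. J s \<Longrightarrow> X s \<or> wp Ownship a J s"
    using assms unfolding wp.simps by blast
  have J_le: "wp Ownship (Loop a) X s'" if "J s'" for s'
    unfolding wp.simps by (rule exI[of _ J]) (use J(2) that in blast)
  have "wp Ownship a J s \<Longrightarrow> wp Ownship a (wp Ownship (Loop a) X) s"
    by (erule wp_mono) (rule J_le)
  then show ?thesis
    using J(2)[OF J(1)] by blast
qed

lemma wp_Loop_unfold_Opponent:
  assumes "wp Opponent (Loop a) X s"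
  shows "X s \<and> wp Opponent a (wp Opponent (Loop a) X) s"
proof -
  obtain J where J: "J s" "\<And>s. J s \<Longrightarrow> X s \<and> wp Opponent a J s"
    using assms unfolding wp.simps by blast
  have J_le: "wp Opponent (Loop a) X s'" if "J s'" for s'
    unfolding wp.simps by (rule exI[of _ J]) (use J(2) that in blast)
  have "wp Opponent a J s \<Longrightarrow> wp Opponent a (wp Opponent (Loop a) X) s"
    by (erule wp_mono) (rule J_le)
  then show ?thesis
    using J(2)[OF J(1)] by blast
qed

text \<open>Each clause of \<open>wp\<close> mirrors the moves of its construct, with the rest of
  the stack as continuation. Only \<open>Loop\<close> needs an argument: its move puts the body
  above the loop itself, which is the fixpoint unfolding.\<close>

lemma stack_wp_Ownship:
  assumes "stack_wp ((Ownship, a) # K) X s"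
  shows "\<exists>e\<in>moves ((Ownship, a) # K, s). stack_wp (fst e) X (snd e)"
proof (cases a)
  case (Loop b)
  then show ?thesis
    using assms wp_Loop_unfold_Ownship[of b "stack_wp K X" s] by (auto simp del: wp.simps)
qed (use assms in auto)

lemma stack_wp_Opponent:
  assumes "stack_wp ((Opponent, a) # K) X s" and "e \<in> moves ((Opponent, a) # K, s)"
  shows "stack_wp (fst e) X (snd e)"
proof (cases a)
  case (Loop b)
  then show ?thesis
    using assms wp_Loop_unfold_Opponent[of b "stack_wp K X" s] by (auto simp del: wp.simps)
qed (use assms in \<open>auto split: if_splits\<close>)

text \<open>The ownship always has a move that preserves \<open>stack_wp\<close>, and no opponent
  move destroys it. It therefore persists along every play, and on the empty stack it is
  \<open>Q\<close> itself.\<close>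

lemma box_if_wp:
  assumes "wp Opponent a Q s"
  shows "box a Q s"
proof -
  define good where "good d \<longleftrightarrow> stack_wp (fst d) Q (snd d)" for d :: "'a position"
  \<comment> \<open>The strategy is positional: histories list the latest position first, so
    \<open>hd \<pi>\<close> is the current one.\<close>
  define \<sigma> :: "'a strategy" where "\<sigma> \<pi> = (SOME e. e \<in> moves (hd \<pi>) \<and> good e)" for \<pi>
  have own: "\<sigma> (d # \<pi>) \<in> moves d \<and> good (\<sigma> (d # \<pi>))"
    if "good d" "to_move d = Some Ownship" for d \<pi>
  proof -
    obtain b K s' where d: "d = ((Ownship, b) # K, s')"
      using \<open>to_move d = Some Ownship\<close> by (cases d rule: to_move.cases) auto
    have "\<exists>e\<in>moves d. stack_wp (fst e) Q (snd e)"
      unfolding d by (rule stack_wp_Ownship) (use \<open>good d\<close> in \<open>simp add: good_def d\<close>)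
    then have "\<exists>e. e \<in> moves d \<and> good e"
      unfolding good_def by blast
    then show ?thesis
      unfolding \<sigma>_def list.sel by (rule someI_ex)
  qed
  have opp: "good e" if "good d" "to_move d = Some Opponent" "e \<in> moves d" for d e
  proof -
    obtain b K s' where "d = ((Opponent, b) # K, s')"
      using \<open>to_move d = Some Opponent\<close> by (cases d rule: to_move.cases) auto
    then show ?thesis
      using that stack_wp_Opponent[of b K Q s' e] by (simp add: good_def)
  qed
  have good_play: "good (hd \<pi>)" if "play \<sigma> ([(Opponent, a)], s) \<pi>" for \<pi>
    using that
  proof induction
    case start
    then show ?case using assms by (simp add: good_def)
  next
    case (step d \<pi> e)
    show ?case
    proof (cases "to_move d")
      case None
      then have "moves d = {}" by (cases d rule: to_move.cases) auto
      then show ?thesis using step by simp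
    next
      case (Some p)
      then show ?thesis using step own opp by (cases p) auto
    qed
  qed
  have "winning \<sigma> ([(Opponent, a)], s) Q"
    unfolding winning_def
  proof (intro allI impI)
    fix d \<pi>
    assume "play \<sigma> ([(Opponent, a)], s) (d # \<pi>)"
    then have "good d" using good_play by fastforce
    then show "case to_move d of None \<Rightarrow> Q (snd d) | Some Ownship \<Rightarrow> \<sigma> (d # \<pi>) \<in> moves d
        | Some Opponent \<Rightarrow> True"
      using own[of d \<pi>] by (cases d rule: to_move.cases) (auto simp: good_def split: player.split)
  qed
  then show ?thesis unfolding box_def by blast
qed

section \<open>Closed form of the dynamics\<close>

lemma ode_reach_alpha3:
  assumes "ode_reach [(X_r, \<lambda>s. - s X_rv), (X_h, \<lambda>s. - s X_v), (X_v, \<lambda>s. s X_ao)] s s'"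
  obtains T where "T \<ge> 0" "s' X_r = s X_r - s X_rv * T"
    "s' X_h = s X_h - (s X_v * T + s X_ao / 2 * T\<^sup>2)" "s' X_v = s X_v + s X_ao * T"
    "\<And>x. x \<notin> {X_r, X_h, X_v} \<Longrightarrow> s' x = s x"
proof -
  let ?ode = "[(X_r, \<lambda>s. - s X_rv), (X_h, \<lambda>s. - s X_v), (X_v, \<lambda>s. s X_ao)]
    :: (var \<times> (var state \<Rightarrow> real)) list"
  obtain T \<phi> where T: "T \<ge> 0" and \<phi>: "\<phi> 0 = s" "\<phi> T = s'"
    and sol: "\<forall>t\<in>{0..T}.
      (\<forall>(x, f)\<in>set ?ode. ((\<lambda>u. \<phi> u x) has_real_derivative f (\<phi> t)) (at t within {0..T})) \<and>
      (\<forall>x. x \<notin> fst ` set ?ode \<longrightarrow> \<phi> t x = s x)"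
    using assms unfolding ode_reach_def by (elim exE conjE) (rule that)
  have deriv_r: "((\<lambda>u. \<phi> u X_r) has_real_derivative - \<phi> t X_rv) (at t within {0..T})"
    if "t \<in> {0..T}" for t
    using conjunct1[OF bspec[OF sol that]] by simp
  have deriv_h: "((\<lambda>u. \<phi> u X_h) has_real_derivative - \<phi> t X_v) (at t within {0..T})"
    if "t \<in> {0..T}" for t
    using conjunct1[OF bspec[OF sol that]] by simp
  have deriv_v: "((\<lambda>u. \<phi> u X_v) has_real_derivative \<phi> t X_ao) (at t within {0..T})"
    if "t \<in> {0..T}" for t
    using conjunct1[OF bspec[OF sol that]] by simp
  have const: "\<phi> t x = s x" if "t \<in> {0..T}" "x \<notin> {X_r, X_h, X_v}" for t x
    using conjunct2[OF bspec[OF sol that(1)]] that(2) by simp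
  \<comment> \<open>Uniqueness of solutions reduces to constancy: a solution minus its expected
    closed form has derivative zero. Derivatives at the endpoints are one-sided, so two-sided ones
    are used in the interior only, with continuity on \<open>{0..t}\<close>.\<close>
  have unique: "f t = f 0"
    if f: "\<And>u. u \<in> {0..T} \<Longrightarrow> (f has_real_derivative 0) (at u within {0..T})"
      and t: "t \<in> {0..T}" for f :: "real \<Rightarrow> real" and t
  proof (cases "t = 0")
    case False
    then have "0 < t" using t by simp
    moreover have "continuous_on {0..t} f"
      by (rule continuous_on_subset[OF DERIV_continuous_on[OF f]]) (use t in auto)
    moreover have "DERIV f u :> 0" if "0 < u" "u < t" for u
      using f[of u] that t by (simp add: at_within_Icc_at)
    ultimately show ?thesis by (rule DERIV_isconst_end)
  qed simp
  have v: "\<phi> t X_v = s X_v + s X_ao * t" if "t \<in> {0..T}" for t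
  proof -
    have "\<phi> t X_v - s X_ao * t = \<phi> 0 X_v - s X_ao * 0"
    proof (rule unique[OF _ that])
      fix u assume u: "u \<in> {0..T}"
      show "((\<lambda>u. \<phi> u X_v - s X_ao * u) has_real_derivative 0) (at u within {0..T})"
        by (rule derivative_eq_intros deriv_v[OF u] refl)+ (simp add: const[OF u])
    qed
    then show ?thesis using \<phi> by simp
  qed
  \<comment> \<open>The altitude is integrated after \<open>v\<close>, whose closed form supplies
    its derivative.\<close>
  have h: "\<phi> T X_h + (s X_v * T + s X_ao / 2 * T\<^sup>2) = \<phi> 0 X_h + (s X_v * 0 + s X_ao / 2 * 0\<^sup>2)"
  proof (rule unique)
    fix u assume u: "u \<in> {0..T}"
    show "((\<lambda>u. \<phi> u X_h + (s X_v * u + s X_ao / 2 * u\<^sup>2)) has_real_derivative 0)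
        (at u within {0..T})"
      by (rule derivative_eq_intros deriv_h[OF u] refl)+ (simp add: v[OF u])
  qed (use T in simp)
  have r: "\<phi> T X_r + s X_rv * T = \<phi> 0 X_r + s X_rv * 0"
  proof (rule unique)
    fix u assume u: "u \<in> {0..T}"
    show "((\<lambda>u. \<phi> u X_r + s X_rv * u) has_real_derivative 0) (at u within {0..T})"
      by (rule derivative_eq_intros deriv_r[OF u] refl)+ (simp add: const[OF u])
  qed (use T in simp)
  show thesis
    by (rule that[OF T]) (use h r v[of T] const[of T] T \<phi> in auto)
qed

section \<open>Nominal climb in the direction of the advisory\<close>

text \<open>
  The nominal displacement, velocity \<open>u\<close> and target velocity \<open>u_lo\<close> all measured in the direction \<open>w\<close>.
\<close>

definition climb :: "real \<Rightarrow> real \<Rightarrow> real \<Rightarrow> real \<Rightarrow> real" where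
  "climb a u u_lo t =
     (if t < max 0 (u_lo - u) / a then a / 2 * t\<^sup>2 + u * t
      else u_lo * t - (max 0 (u_lo - u))\<^sup>2 / (2 * a))"

lemma climb_0: "a > 0 \<Longrightarrow> climb a u u_lo 0 = 0"
  by (auto simp: climb_def max_def field_simps)

text \<open>As \<open>w\<close> squares to one, multiplying by it is invertible and turns both
  advisory directions into the upward one. In the second phase \<open>t \<ge> 0\<close> follows from
  the nonnegative switching time.\<close>

lemma A_lo_iff_climb:
  assumes "a > 0" and w: "w = - 1 \<or> w = 1"
  shows "A_lo a v w v_lo h t \<longleftrightarrow> t \<ge> 0 \<and> w * h = climb a (w * v) (w * v_lo) t"
proof -
  have "0 \<le> max 0 (w * (v_lo - v)) / a" using assms by simp
  then show ?thesis
    using w unfolding A_lo_def T_lo_def climb_def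
    by (auto simp: algebra_simps)
qed

text \<open>As long as the target is not reached by time \<open>t\<close>, the accelerated path is
  the nominal one and both sides agree. Accelerating past the target only gains height, and from a
  start above it the nominal path continues at the lower velocity \<open>u_lo\<close> at
  once.\<close>

lemma climb_shift:
  assumes a: "a > 0" and t: "t \<ge> 0" and s: "s \<ge> 0"
  shows "climb a u u_lo (t + s) \<le> u * t + a / 2 * t\<^sup>2 + climb a (u + a * t) u_lo s"
proof (cases "u_lo \<le> u")
  case True
  have "u_lo * t \<le> u * t" "0 \<le> a * t" "0 \<le> a * t\<^sup>2"
    using True a t by (auto intro: mult_right_mono)
  then show ?thesis
    using True s t by (simp add: climb_def max_def algebra_simps)
next
  case False
  show ?thesis
  proof (cases "a * t < u_lo - u")
    \<comment> \<open>Both sides switch phase at the same instant, and in each phase they are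
      equal.\<close>
    case True
    then have "(t + s < (u_lo - u) / a) = (s < (u_lo - (u + a * t)) / a)"
      using a by (simp add: field_simps)
    then show ?thesis
      using True False a t s
      by (simp add: climb_def max_def) (simp add: field_simps power2_eq_square)
  next
    case reached: False
    \<comment> \<open>The height gained by overshooting during \<open>t\<close> is a completed
      square.\<close>
    have "0 \<le> (a * t - (u_lo - u))\<^sup>2 / (2 * a)" using a by simp
    moreover have "(a * t - (u_lo - u))\<^sup>2 / (2 * a)
        = u * t + a / 2 * t\<^sup>2 - (u_lo * t - (u_lo - u)\<^sup>2 / (2 * a))"
      using a by (simp add: field_simps power2_eq_square)
    moreover have "\<not> t + s < (u_lo - u) / a"
    proof -
      have "a * t \<le> a * (t + s)" using a s by simp
      then show ?thesis using reached a by (simp add: field_simps)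
    qed
    moreover have "\<not> s < 0" using s by simp
    ultimately show ?thesis
      using reached False by (simp add: climb_def max_def algebra_simps)
  qed
qed

section \<open>Safety and invariance of the region\<close>

lemma L_impl_iff_climb:
  assumes "a_lo > 0" and w: "w = - 1 \<or> w = 1"
  shows "L_impl r_p h_p a_lo v_max r h v w v_lo \<longleftrightarrow>
    (\<forall>t\<ge>0. \<forall>c\<in>{0..v_max}. \<bar>r - c * t\<bar> > r_p \<or> climb a_lo (w * v) (w * v_lo) t - w * h > h_p)"
    (is "_ \<longleftrightarrow> ?R")
proof
  assume L: "L_impl r_p h_p a_lo v_max r h v w v_lo"
  show ?R
  proof (intro allI impI ballI)
    fix t c :: real
    assume t: "t \<ge> 0" and c: "c \<in> {0..v_max}"
    let ?N = "climb a_lo (w * v) (w * v_lo) t"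
    \<comment> \<open>\<open>w\<close> is its own inverse, so the nominal height whose directed
      climb is \<open>?N\<close> is \<open>w * ?N\<close>.\<close>
    have "w * (w * ?N) = ?N" using w by auto
    then have "A_lo a_lo v w v_lo (w * ?N) t"
      using t assms by (simp add: A_lo_iff_climb)
    then have "\<bar>r - c * t\<bar> > r_p \<or> w * (w * ?N - h) > h_p"
      using L c unfolding L_impl_def by blast
    then show "\<bar>r - c * t\<bar> > r_p \<or> ?N - w * h > h_p"
      using \<open>w * (w * ?N) = ?N\<close> by (simp add: right_diff_distrib)
  qed
next
  assume ?R
  then show "L_impl r_p h_p a_lo v_max r h v w v_lo"
    unfolding L_impl_def A_lo_iff_climb[OF assms] by (auto simp: right_diff_distrib)
qed

text \<open>At time \<open>0\<close> with closure rate \<open>0\<close> the climb vanishes, which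
  leaves \<open>- (w * h) > h_p\<close> with \<open>w\<close> of absolute value one.\<close>

lemma L_impl_safe:
  assumes "a_lo > 0" "w = - 1 \<or> w = 1" "v_max > 0"
    and "L_impl r_p h_p a_lo v_max r h v w v_lo"
  shows "\<bar>r\<bar> > r_p \<or> \<bar>h\<bar> > h_p"
proof -
  have "\<bar>r - 0 * 0\<bar> > r_p \<or> climb a_lo (w * v) (w * v_lo) 0 - w * h > h_p"
    using assms unfolding L_impl_iff_climb[OF assms(1,2)]
    by (metis atLeastAtMost_iff less_eq_real_def)
  then show ?thesis
    using assms by (auto simp: climb_0)
qed

text \<open>Time \<open>t\<close> after the evolution is time \<open>T + t\<close> before it.
  Averaging the closure rates matches the horizontal distances, and \<open>climb_shift\<close>
  compares the vertical ones.\<close>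

lemma L_impl_evolve:
  assumes a: "a_lo > 0" and w: "w = - 1 \<or> w = 1" and c: "c \<in> {0..v_max}" and T: "T \<ge> 0"
    and L: "L_impl r_p h_p a_lo v_max r h v w v_lo"
  shows "L_impl r_p h_p a_lo v_max (r - c * T) (h - (v * T + w * a_lo / 2 * T\<^sup>2))
    (v + w * a_lo * T) w v_lo"
  unfolding L_impl_iff_climb[OF a w]
proof (intro allI impI ballI)
  fix t d :: real
  assume t: "t \<ge> 0" and d: "d \<in> {0..v_max}"
  \<comment> \<open>\<open>e\<close> is the average of \<open>c\<close> and \<open>d\<close>
    weighted by the durations \<open>T\<close> and \<open>t\<close>, hence stays in the interval.
    With total duration zero any rate works; \<open>c\<close> is taken.\<close>
  obtain e where e: "e \<in> {0..v_max}" "e * (T + t) = c * T + d * t"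
  proof (cases "T + t = 0")
    case True
    then have "T = 0" "t = 0" using t T by auto
    then show ?thesis using that[of c] c by simp
  next
    case False
    then have pos: "T + t > 0" using t T by simp
    have "c * T + d * t \<le> v_max * T + v_max * t"
      using c d t T by (intro add_mono mult_right_mono) auto
    then have "(c * T + d * t) / (T + t) \<le> v_max"
      using pos by (simp add: pos_divide_le_eq distrib_left)
    moreover have "0 \<le> (c * T + d * t) / (T + t)"
      using c d t T by auto
    ultimately show ?thesis
      using that[of "(c * T + d * t) / (T + t)"] pos by simp
  qed
  have "T + t \<ge> 0" using t T by simp
  then have "\<bar>r - e * (T + t)\<bar> > r_p \<or> climb a_lo (w * v) (w * v_lo) (T + t) - w * h > h_p"
    using L e(1) unfolding L_impl_iff_climb[OF a w] by blast
  moreover have "climb a_lo (w * v) (w * v_lo) (T + t)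
      \<le> w * v * T + a_lo / 2 * T\<^sup>2 + climb a_lo (w * v + a_lo * T) (w * v_lo) t"
    using climb_shift[OF a T t] .
  moreover have "w * (v + w * a_lo * T) = w * v + a_lo * T"
    "w * (h - (v * T + w * a_lo / 2 * T\<^sup>2)) = w * h - (w * v * T + a_lo / 2 * T\<^sup>2)"
    using w by (auto simp: algebra_simps)
  ultimately show "\<bar>r - c * T - d * t\<bar> > r_p \<or>
      climb a_lo (w * (v + w * a_lo * T)) (w * v_lo) t
        - w * (h - (v * T + w * a_lo / 2 * T\<^sup>2)) > h_p"
    unfolding e(2) by (auto simp: diff_diff_eq)
qed

section \<open>Loop invariants and the ownship's response\<close>

theorem theorem5p2:
  fixes r_p h_p a_lo a_max v_max :: real
  shows "valid (\<lambda>s :: var state.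
    r_p \<ge> 0 \<and> h_p > 0 \<and> s X_rv \<ge> 0 \<and> a_lo > 0 \<and> v_max > 0 \<and>
    (s X_w = - 1 \<or> s X_w = 1) \<and> a_max \<ge> a_lo \<and>
    L_impl r_p h_p a_lo v_max (s X_r) (s X_h) (s X_v) (s X_w) (s X_vlo) \<longrightarrow>
    box (Loop (alpha3 r_p h_p a_lo a_max v_max)) (\<lambda>s. \<bar>s X_r\<bar> > r_p \<or> \<bar>s X_h\<bar> > h_p) s)"
  unfolding valid_def
proof (intro allI impI, elim conjE)
  fix s0 :: "var state"
  assume a: "a_lo > 0" "a_max \<ge> a_lo" and v_max: "v_max > 0"
    and init: "s0 X_w = - 1 \<or> s0 X_w = 1"
      "L_impl r_p h_p a_lo v_max (s0 X_r) (s0 X_h) (s0 X_v) (s0 X_w) (s0 X_vlo)"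
  \<comment> \<open>\<open>J\<close> is the invariant of the outer loop. \<open>J'\<close> adds the
    acceleration to which the ownship has committed and is the invariant of the inner loop.\<close>
  define J where "J s \<longleftrightarrow> (s X_w = - 1 \<or> s X_w = 1) \<and> L_state r_p h_p a_lo v_max s"
    for s :: "var state"
  define J' where "J' s \<longleftrightarrow> J s \<and> s X_ao = s X_w * a_lo" for s :: "var state"
  let ?ode = "[(X_r, \<lambda>s. - s X_rv), (X_h, \<lambda>s. - s X_v), (X_v, \<lambda>s. s X_ao)]"
  let ?inner = "AssignAny X_rv ;; Test (\<lambda>s. 0 \<le> s X_rv \<and> s X_rv \<le> v_max) ;; Evolve ?ode"
  let ?control = "Dual (AssignAny X_ao ;; Test (\<lambda>s. - a_max \<le> s X_ao \<and> s X_ao \<le> a_max))"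
  have evolve: "J' s'" if "J' s" "0 \<le> s X_rv" "s X_rv \<le> v_max" "ode_reach ?ode s s'" for s s'
  proof -
    obtain T where "T \<ge> 0" "s' X_r = s X_r - s X_rv * T"
      "s' X_h = s X_h - (s X_v * T + s X_ao / 2 * T\<^sup>2)" "s' X_v = s X_v + s X_ao * T"
      "\<And>x. x \<notin> {X_r, X_h, X_v} \<Longrightarrow> s' x = s x"
      using ode_reach_alpha3[OF \<open>ode_reach ?ode s s'\<close>] by metis
    then show ?thesis
      using that L_impl_evolve[of a_lo "s X_w" "s X_rv" v_max T] a
      unfolding J'_def J_def L_state_def by auto
  qed
  have J'_rv: "J' (s(X_rv := c)) \<longleftrightarrow> J' s" for s c
    by (simp add: J'_def J_def L_state_def)
  have inner: "wp Opponent ?inner J' s" if "J' s" for s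
    unfolding wp.simps
  proof (intro allI impI)
    fix c s'
    assume "0 \<le> (s(X_rv := c)) X_rv \<and> (s(X_rv := c)) X_rv \<le> v_max"
      "ode_reach ?ode (s(X_rv := c)) s'"
    then show "J' s'"
      using evolve[of "s(X_rv := c)" s'] that J'_rv by simp
  qed
  have inner_loop: "wp Opponent (Loop ?inner) J s" if "J' s" for s
    using that by (rule wp_Loop_invariant[of J']) (simp add: J'_def, rule inner)
  have control: "wp Opponent ?control (wp Opponent (Loop ?inner) J) s" if "J s" for s
  proof -
    \<comment> \<open>The ownship's choice inside \<open>Dual\<close> is to accelerate at
      \<open>a_lo\<close> in the advisory direction; \<open>a_max \<ge> a_lo\<close> makes it pass
      its own test.\<close>
    have "J' (s(X_ao := s X_w * a_lo))"
      using that by (simp add: J'_def J_def L_state_def)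
    then have "wp Opponent (Loop ?inner) J (s(X_ao := s X_w * a_lo))"
      by (rule inner_loop)
    moreover have "- a_max \<le> s X_w * a_lo \<and> s X_w * a_lo \<le> a_max"
      using that a by (auto simp: J_def)
    \<comment> \<open>The equation left out is the opponent's loop clause, so that the inner loop
      stays folded.\<close>
    ultimately show ?thesis
      unfolding wp.simps(1-11,13) other.simps by (intro exI[of _ "s X_w * a_lo"]) simp
  qed
  have adv: "J (s(X_adv_w := c, X_adv_vlo := d)) \<longleftrightarrow> J s" for s c d
    by (simp add: J_def L_state_def)
  have body: "wp Opponent (alpha3 r_p h_p a_lo a_max v_max) J s" if "J s" for s
  proof -
    \<comment> \<open>A new advisory has passed the test for \<open>L_state\<close>, which
      re-establishes \<open>J\<close>; if the old one is kept, \<open>J\<close> persists.\<close>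
    have "J (s(X_w := w, X_vlo := c))"
      if "w = - 1 \<or> w = 1" "L_state r_p h_p a_lo v_max (s(X_w := w, X_vlo := c))" for w c
      using that by (simp add: J_def)
    then show ?thesis
      unfolding alpha3_def wp.simps(1-11) using \<open>J s\<close>
      by (intro conjI allI impI control) (simp_all add: adv)
  qed
  have "\<bar>s X_r\<bar> > r_p \<or> \<bar>s X_h\<bar> > h_p" if "J s" for s
    using that L_impl_safe a(1) v_max unfolding J_def L_state_def by blast
  moreover have "J s0" using init by (simp add: J_def L_state_def)
  ultimately have "wp Opponent (Loop (alpha3 r_p h_p a_lo a_max v_max))
      (\<lambda>s. \<bar>s X_r\<bar> > r_p \<or> \<bar>s X_h\<bar> > h_p) s0"
    by (intro wp_Loop_invariant[of J] body)
  then show "box (Loop (alpha3 r_p h_p a_lo a_max v_max))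
      (\<lambda>s. \<bar>s X_r\<bar> > r_p \<or> \<bar>s X_h\<bar> > h_p) s0"
    by (rule box_if_wp)
qed

end
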